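(* Let $\varphi_e$ and $\varphi_{e_1}$ be two ruled surfaces in $\mathbb{R}^3$ that form a Bertrand surface offset, with offset angle $\theta$ and offset distance $\theta^*$. Then, at corresponding parameters, $$\Delta_1=\frac{\Delta\cos\theta+\delta\sin\theta+\theta^*(\gamma\cos\theta-\sin\theta)}{\cos\theta+\gamma\sin\theta}.$$
   Context: Dual numbers are $\bar a=a+\varepsilon a^*$ with $a,a^*\in\mathbb{R}$, $\varepsilon\neq 0$, $\varepsilon^2=0$. For a differentiable real function $f$, $f(x+\varepsilon x^* )=f(x)+\varepsilon x^*f'(x)$; e.g. $\cos(x+\varepsilon x^* )=\cos x-\varepsilon x^*\sin x$, $\sin(x+\varepsilon x^* )=\sin x+\varepsilon x^*\cos x$. Dual vectors are $\tilde a=\vec a+\varepsilon\vec a^*$ with $\vec a,\vec a^*\in\mathbb{R}^3$; scalar and vector products are extended $\varepsilon$-bilinearly. A ruled surface $\varphi_e=\vec c(s)+v\,\vec e(s)$ (all data smooth) is parametrized so that $\langle \vec e,\vec e\rangle=1$, $\langle \vec e',\vec e'\rangle=1$, $\langle \vec c',\vec e'\rangle=0$, where prime is $d/ds$; so $s$ is the arc length of the real indicatrix $\vec e(s)$ and $\vec c$ is the striction line. It is represented by the dual unit vector $\tilde e=\vec e+\varepsilon\,\vec c\times\vec e$. Put $\vec t=\vec e'$, $\vec g=\vec e\times\vec t$; the conical curvature $\gamma$ is defined by $\vec e'=\vec t$, $\vec t'=\gamma\vec g-\vec e$, $\vec g'=-\gamma\vec t$. Put $\Delta=\det(\vec c',\vec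 e,\vec t)$, $\delta=\langle\vec c',\vec e\rangle$. The dual Darboux frame is $\{\tilde e,\tilde t,\tilde g\}$ with $\tilde t=\vec t+\varepsilon\,\vec c\times\vec t$, $\tilde g=\vec g+\varepsilon\,\vec c\times\vec g$. The corresponding objects of a second ruled surface $\varphi_{e_1}$ (with its own parameter $s_1$, derivatives taken with respect to $s_1$) carry the subscript $1$; e.g. $\Delta_1=\det(d\vec c_1/ds_1,\vec e_1,\vec t_1)$. $\varphi_e$ and $\varphi_{e_1}$ form a Bertrand surface offset if, under a correspondence $s_1=s_1(s)$ between their rulings (differentiable with nonvanishing derivative), $\tilde t=\tilde t_1$ at corresponding parameters. The frames are then related by $\tilde e_1=\cos\bar\theta\,\tilde e-\sin\bar\theta\,\tilde g$, $\tilde t_1=\tilde t$, $\tilde g_1=\sin\bar\theta\,\tilde e+\cos\bar\theta\,\tilde g$, where $\bar\theta=\theta+\varepsilon\theta^*$ ($0\le\theta\le\pi$, $\theta^*\in\mathbb{R}$) is the dual angle between $\tilde e$ and $\tilde e_1$; $\theta$ is the offset angle and $\theta^*$ the offset distance. *)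

theory Defs
  imports "HOL-Analysis.Analysis"
begin

section \<open>Dual numbers and dual vectors\<close>

text \<open>\<open>Dual a b\<close> stands for \<open>a + \<epsilon> b\<close> with \<open>\<epsilon>\<^sup>2 = 0\<close>. Dual numbers are \<open>real dual\<close>, dual vectors
  are \<open>(real^3) dual\<close>.\<close>

datatype 'a dual = Dual (real_part: 'a) (dual_part: 'a)

instantiation dual :: (plus) plus
begin
definition plus_dual :: "'a dual \<Rightarrow> 'a dual \<Rightarrow> 'a dual" where
  "x + y = Dual (real_part x + real_part y) (dual_part x + dual_part y)"
instance ..
end

instantiation dual :: (minus) minus
begin
definition minus_dual :: "'a dual \<Rightarrow> 'a dual \<Rightarrow> 'a dual" where
  "x - y = Dual (real_part x - real_part y) (dual_part x - dual_part y)"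
instance ..
end

text \<open>\<open>(a + \<epsilon> a')(u + \<epsilon> u') = a u + \<epsilon> (a u' + a' u)\<close>\<close>

definition dual_scale :: "real dual \<Rightarrow> 'a::real_vector dual \<Rightarrow> 'a dual" (infixr \<open>*\<^sub>D\<close> 75) where
  "x *\<^sub>D u = Dual (real_part x *\<^sub>R real_part u)
                (real_part x *\<^sub>R dual_part u + dual_part x *\<^sub>R real_part u)"

text \<open>\<open>f (x + \<epsilon> x') = f x + \<epsilon> x' f' x\<close>\<close>

definition dual_extend :: "(real \<Rightarrow> real) \<Rightarrow> real dual \<Rightarrow> real dual" where
  "dual_extend f x = Dual (f (real_part x)) (dual_part x * deriv f (real_part x))"

lemma dual_extend_cos: "dual_extend cos (Dual x y) = Dual (cos x) (- (y * sin x))"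
proof -
  have "deriv cos x = - sin x"
    by (rule DERIV_imp_deriv) (auto intro!: derivative_eq_intros)
  then show ?thesis
    by (simp add: dual_extend_def)
qed

lemma dual_extend_sin: "dual_extend sin (Dual x y) = Dual (sin x) (y * cos x)"
proof -
  have "deriv sin x = cos x"
    by (rule DERIV_imp_deriv) (auto intro!: derivative_eq_intros)
  then show ?thesis
    by (simp add: dual_extend_def)
qed


section \<open>Ruled surfaces\<close>

definition vderiv :: "(real \<Rightarrow> 'a::real_normed_vector) \<Rightarrow> real \<Rightarrow> 'a" where
  "vderiv f s = vector_derivative f (at s)"

text \<open>The set is meant to be open; then all iterated derivatives depend only on the values of
  the curve on the set.\<close>

definition smooth_curve_on :: "real set \<Rightarrow> (real \<Rightarrow> 'a::real_normed_vector) \<Rightarrow> bool" where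
  "smooth_curve_on I f \<longleftrightarrow> (\<forall>n. \<forall>s\<in>I. (vderiv ^^ n) f differentiable (at s))"

text \<open>A ruled surface \<open>(s, v) \<mapsto> c s + v e s\<close> is given by its striction line \<open>c\<close> and its
  director curve \<open>e\<close>, parametrized by the arc length of \<open>e\<close>.\<close>

definition ruled_surface :: "real set \<Rightarrow> (real \<Rightarrow> real^3) \<Rightarrow> (real \<Rightarrow> real^3) \<Rightarrow> bool" where
  "ruled_surface I c e \<longleftrightarrow>
     open I \<and> is_interval I \<and> smooth_curve_on I c \<and> smooth_curve_on I e \<and>
     (\<forall>s\<in>I. e s \<bullet> e s = 1 \<and> vderiv e s \<bullet> vderiv e s = 1 \<and> vderiv c s \<bullet> vderiv e s = 0)"

definition tangent_vec :: "(real \<Rightarrow> real^3) \<Rightarrow> real \<Rightarrow> real^3" where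
  "tangent_vec e s = vderiv e s"

definition normal_vec :: "(real \<Rightarrow> real^3) \<Rightarrow> real \<Rightarrow> real^3" where
  "normal_vec e s = cross3 (e s) (tangent_vec e s)"

definition conical_curvature :: "(real \<Rightarrow> real^3) \<Rightarrow> real \<Rightarrow> real" where
  "conical_curvature e s = (THE k.
     vderiv e s = tangent_vec e s \<and>
     vderiv (tangent_vec e) s = k *\<^sub>R normal_vec e s - e s \<and>
     vderiv (normal_vec e) s = - k *\<^sub>R tangent_vec e s)"

definition Delta_inv :: "(real \<Rightarrow> real^3) \<Rightarrow> (real \<Rightarrow> real^3) \<Rightarrow> real \<Rightarrow> real" where
  "Delta_inv c e s = det (vector [vderiv c s, e s, tangent_vec e s] :: real^3^3)"

definition delta_inv :: "(real \<Rightarrow> real^3) \<Rightarrow> (real \<Rightarrow> real^3) \<Rightarrow> real \<Rightarrow> real" where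
  "delta_inv c e s = vderiv c s \<bullet> e s"

text \<open>The dual vector of the oriented line through \<open>p\<close> with direction \<open>u\<close>.\<close>

definition line_dual :: "real^3 \<Rightarrow> real^3 \<Rightarrow> (real^3) dual" where
  "line_dual p u = Dual u (cross3 p u)"

definition dual_e :: "(real \<Rightarrow> real^3) \<Rightarrow> (real \<Rightarrow> real^3) \<Rightarrow> real \<Rightarrow> (real^3) dual" where
  "dual_e c e s = line_dual (c s) (e s)"

definition dual_t :: "(real \<Rightarrow> real^3) \<Rightarrow> (real \<Rightarrow> real^3) \<Rightarrow> real \<Rightarrow> (real^3) dual" where
  "dual_t c e s = line_dual (c s) (tangent_vec e s)"

definition dual_g :: "(real \<Rightarrow> real^3) \<Rightarrow> (real \<Rightarrow> real^3) \<Rightarrow> real \<Rightarrow> (real^3) dual" where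
  "dual_g c e s = line_dual (c s) (normal_vec e s)"


section \<open>Bertrand surface offsets\<close>

text \<open>\<open>\<sigma>\<close> is the correspondence \<open>s\<^sub>1 = s\<^sub>1(s)\<close>; every object of the second surface is formed with
  respect to its own parameter and then evaluated at \<open>\<sigma> s\<close>.\<close>

definition bertrand_offset ::
  "real set \<Rightarrow> (real \<Rightarrow> real^3) \<Rightarrow> (real \<Rightarrow> real^3) \<Rightarrow>
   real set \<Rightarrow> (real \<Rightarrow> real^3) \<Rightarrow> (real \<Rightarrow> real^3) \<Rightarrow> (real \<Rightarrow> real) \<Rightarrow> bool" where
  "bertrand_offset I c e J c1 e1 \<sigma> \<longleftrightarrow>
     ruled_surface I c e \<and> ruled_surface J c1 e1 \<and> bij_betw \<sigma> I J \<and>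
     (\<forall>s\<in>I. \<sigma> differentiable (at s) \<and> deriv \<sigma> s \<noteq> 0 \<and> dual_t c e s = dual_t c1 e1 (\<sigma> s))"

text \<open>The dual angle from \<open>e\<close> to \<open>e\<^sub>1\<close> is oriented: the frame relation, and not just the value of
  the cosine, fixes the sign of its sine.\<close>

definition offset_dual_angle ::
  "(real \<Rightarrow> real^3) \<Rightarrow> (real \<Rightarrow> real^3) \<Rightarrow> (real \<Rightarrow> real^3) \<Rightarrow> (real \<Rightarrow> real^3) \<Rightarrow>
   (real \<Rightarrow> real) \<Rightarrow> real \<Rightarrow> real dual \<Rightarrow> bool" where
  "offset_dual_angle c e c1 e1 \<sigma> s \<phi> \<longleftrightarrow>
     0 \<le> real_part \<phi> \<and> real_part \<phi> \<le> pi \<and>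
     dual_e c1 e1 (\<sigma> s) = dual_extend cos \<phi> *\<^sub>D dual_e c e s - dual_extend sin \<phi> *\<^sub>D dual_g c e s \<and>
     dual_t c1 e1 (\<sigma> s) = dual_t c e s \<and>
     dual_g c1 e1 (\<sigma> s) = dual_extend sin \<phi> *\<^sub>D dual_e c e s + dual_extend cos \<phi> *\<^sub>D dual_g c e s"

end

theory Submission
  imports Defs
begin

text \<open>Once the frame equations \<open>t' = \<gamma> g - e\<close> and \<open>g' = - \<gamma> t\<close> are known, everything follows by
  differentiating scalar products that vanish along the correspondence. From \<open>\<langle>e\<^sub>1(\<sigma>), t\<rangle> = 0\<close> one
  gets \<open>\<sigma>' = cos \<theta> + \<gamma> sin \<theta>\<close>, the denominator of the formula.
  The equality of the dual vectors \<open>t\<close> and \<open>t\<^sub>1\<close>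
  says that both striction points lie on the common central normal, and the dual part of the frame
  relation places them at signed distance \<open>\<theta>\<^sup>*\<close>: the vector \<open>d = c\<^sub>1(\<sigma>) - c\<close> equals \<open>\<theta>\<^sup>* t\<close>. Thus
  \<open>\<langle>d, e\<rangle> = 0\<close> and \<open>\<langle>d, g\<rangle> = 0\<close> along the surface, and
  differentiating these and using the frame equations gives \<open>\<langle>d', e\<rangle> = - \<theta>\<^sup>*\<close> and
  \<open>\<langle>d', g\<rangle> = \<theta>\<^sup>* \<gamma>\<close>. As \<open>\<Delta>\<^sub>1 = \<langle>c\<^sub>1', g\<^sub>1\<rangle>\<close> with \<open>g\<^sub>1 = sin \<theta> e + cos \<theta> g\<close>, the
  product \<open>\<sigma>' \<Delta>\<^sub>1 = \<langle>c' + d', g\<^sub>1\<rangle>\<close> is the numerator, and \<open>\<sigma>'\<close> is nonzero for a Bertrand offset.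

  Scalar products are the right quantities to differentiate because \<open>\<theta>\<close> and \<open>\<theta>\<^sup>*\<close> are given only
  pointwise, through the frame relation: both cancel from the products above, whose factors are built
  from the two surfaces and the correspondence and so are differentiable.\<close>

section \<open>The moving frame of a ruled surface\<close>

text \<open>The product rule in the form that turns orthogonality and normalization relations along a
  curve into relations between derivatives.\<close>

lemma derivative_of_constant_inner:
  fixes f h :: "real \<Rightarrow> 'a::real_inner"
  assumes "open I" "s \<in> I" and const: "\<And>r. r \<in> I \<Longrightarrow> f r \<bullet> h r = k"
    and f: "(f has_vector_derivative f') (at s)" and h: "(h has_vector_derivative h') (at s)"
  shows "f' \<bullet> h s + f s \<bullet> h' = 0"
proof -
  have "((\<lambda>r. f r \<bullet> h r) has_vector_derivative (f s \<bullet> h' + f' \<bullet> h s)) (at s)"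
    by (rule bounded_bilinear.has_vector_derivative[OF bounded_bilinear_inner f h])
  moreover have "((\<lambda>r. f r \<bullet> h r) has_vector_derivative 0) (at s)"
    by (rule has_vector_derivative_transform_within_open[OF has_vector_derivative_const[of k]
          assms(1,2)]) (simp add: const)
  ultimately have "f s \<bullet> h' + f' \<bullet> h s = 0"
    by (rule vector_derivative_unique_at)
  then show ?thesis by simp
qed

text \<open>The difference \<open>y\<close> of the two sides is orthogonal to \<open>e\<close>, \<open>t\<close> and \<open>g = e \<times> t\<close>. By the triple
  product identity \<open>y \<times> (e \<times> t) = 0\<close> as well, so \<open>y\<close> is both parallel and orthogonal to the unit
  vector \<open>g\<close>, hence zero.\<close>

lemma orthonormal_expansion:
  fixes e t x :: "real^3"
  assumes "e \<bullet> e = 1" "t \<bullet> t = 1" "e \<bullet> t = 0"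
  shows "x = (x \<bullet> e) *\<^sub>R e + (x \<bullet> t) *\<^sub>R t + (x \<bullet> cross3 e t) *\<^sub>R cross3 e t"
proof -
  define g where "g = cross3 e t"
  have eg: "e \<bullet> g = 0" "t \<bullet> g = 0"
    by (simp_all add: g_def dot_cross_self)
  have "(norm g)\<^sup>2 = 1"
    using norm_cross_dot[of e t] assms by (simp add: g_def norm_eq_sqrt_inner)
  then have gg: "g \<bullet> g = 1" and ng: "norm g = 1"
    by (simp_all add: power2_norm_eq_inner norm_eq_sqrt_inner)
  define y where "y = x - ((x \<bullet> e) *\<^sub>R e + (x \<bullet> t) *\<^sub>R t + (x \<bullet> g) *\<^sub>R g)"
  have y: "y \<bullet> e = 0" "y \<bullet> t = 0" "y \<bullet> g = 0"
    using assms eg gg by (simp_all add: y_def algebra_simps inner_commute)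
  have "cross3 y g = 0"
    using y by (simp add: g_def Lagrange)
  then have "y = 0"
    using norm_cross_dot[of y g] y ng by simp
  then show ?thesis by (simp add: y_def g_def)
qed

lemma smooth_curve_has_derivative:
  assumes "smooth_curve_on I f" "s \<in> I"
  shows "(f has_vector_derivative vderiv f s) (at s)"
    and "(vderiv f has_vector_derivative vderiv (vderiv f) s) (at s)"
proof -
  have "(vderiv ^^ n) f differentiable (at s)" for n
    using assms by (simp add: smooth_curve_on_def)
  from this[of 0] this[of 1]
  show "(f has_vector_derivative vderiv f s) (at s)"
    "(vderiv f has_vector_derivative vderiv (vderiv f) s) (at s)"
    by (simp_all add: vderiv_def vector_derivative_works)
qed

lemma frame_orthonormal:
  assumes "ruled_surface I c e" "s \<in> I"
  shows "e s \<bullet> e s = 1" "tangent_vec e s \<bullet> tangent_vec e s = 1" "e s \<bullet> tangent_vec e s = 0"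
    "normal_vec e s \<bullet> normal_vec e s = 1" "e s \<bullet> normal_vec e s = 0"
    "tangent_vec e s \<bullet> normal_vec e s = 0"
proof -
  have I: "open I" and sm: "smooth_curve_on I e" and un: "\<And>r. r \<in> I \<Longrightarrow> e r \<bullet> e r = 1"
    and tt: "tangent_vec e s \<bullet> tangent_vec e s = 1"
    using assms by (auto simp: ruled_surface_def tangent_vec_def)
  note d = smooth_curve_has_derivative(1)[OF sm assms(2)]
  have et: "e s \<bullet> tangent_vec e s = 0"
    using derivative_of_constant_inner[OF I assms(2) un d d]
    by (simp add: tangent_vec_def inner_commute)
  have "(norm (normal_vec e s))\<^sup>2 = 1"
    using norm_cross_dot[of "e s" "tangent_vec e s"] et tt un[OF assms(2)]
    by (simp add: normal_vec_def norm_eq_sqrt_inner)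
  then show "normal_vec e s \<bullet> normal_vec e s = 1"
    by (simp add: power2_norm_eq_inner)
  show "e s \<bullet> e s = 1" "tangent_vec e s \<bullet> tangent_vec e s = 1" "e s \<bullet> tangent_vec e s = 0"
    "e s \<bullet> normal_vec e s = 0" "tangent_vec e s \<bullet> normal_vec e s = 0"
    using un[OF assms(2)] tt et by (simp_all add: normal_vec_def dot_cross_self)
qed

text \<open>The curvature is the component \<open>\<langle>t', g\<rangle>\<close>: the other two components of \<open>t'\<close> are forced by
  \<open>\<langle>t, t\<rangle> = 1\<close> and \<open>\<langle>t, e\<rangle> = 0\<close>, and \<open>g' = e \<times> t'\<close>. This
  exhibits a number satisfying the defining frame equations; it is unique because \<open>g \<noteq> 0\<close>.\<close>

lemma frame_derivatives:
  assumes rs: "ruled_surface I c e" and s: "s \<in> I"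
  shows "(tangent_vec e has_vector_derivative
            conical_curvature e s *\<^sub>R normal_vec e s - e s) (at s)"
    and "(normal_vec e has_vector_derivative
            - conical_curvature e s *\<^sub>R tangent_vec e s) (at s)"
proof -
  let ?t = "tangent_vec e s" and ?g = "normal_vec e s" and ?dt = "vderiv (vderiv e) s"
  define k where "k = ?dt \<bullet> ?g"
  have I: "open I" and sm: "smooth_curve_on I e"
    using rs by (auto simp: ruled_surface_def)
  note on = frame_orthonormal[OF rs]
  have t_eq: "tangent_vec e = vderiv e"
    by (simp add: tangent_vec_def fun_eq_iff)
  have de: "(e has_vector_derivative ?t) (at s)"
    and dt: "(tangent_vec e has_vector_derivative ?dt) (at s)"
    using smooth_curve_has_derivative[OF sm s] by (simp_all add: t_eq)
  have "?dt \<bullet> ?t = 0"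
    using derivative_of_constant_inner[OF I s on(2) dt dt] by (simp add: inner_commute)
  moreover have "?dt \<bullet> e s = -1"
    using derivative_of_constant_inner[OF I s on(3) de dt] on(2)[OF s]
    by (simp add: inner_commute)
  ultimately have dt_eq: "?dt = k *\<^sub>R ?g - e s"
    using orthonormal_expansion[of "e s" ?t ?dt] on(1-3)[OF s]
    by (simp add: k_def normal_vec_def)
  have "cross3 (e s) ?g = - ?t"
    using on(1,3)[OF s] by (simp add: normal_vec_def Lagrange inner_commute)
  then have dg_eq: "cross3 (e s) ?dt + cross3 ?t ?t = - k *\<^sub>R ?t"
    by (simp add: dt_eq cross_mult_right Cross3.right_diff_distrib)
  have dg: "(normal_vec e has_vector_derivative - k *\<^sub>R ?t) (at s)"
    using bounded_bilinear.has_vector_derivative[OF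
        bilinear_conv_bounded_bilinear[THEN iffD1, OF bilinear_cross] de dt] dg_eq
    by (simp add: normal_vec_def[abs_def])
  have vt: "vderiv (tangent_vec e) s = k *\<^sub>R ?g - e s"
    and vg: "vderiv (normal_vec e) s = - k *\<^sub>R ?t"
    using dt_eq dg by (simp_all add: t_eq vderiv_def vector_derivative_at)
  have "?g \<noteq> 0"
    using on(4)[OF s] by auto
  then have "conical_curvature e s = k"
    unfolding conical_curvature_def by (intro the_equality) (auto simp: tangent_vec_def vt vg)
  then show "(tangent_vec e has_vector_derivative
            conical_curvature e s *\<^sub>R normal_vec e s - e s) (at s)"
    "(normal_vec e has_vector_derivative
            - conical_curvature e s *\<^sub>R tangent_vec e s) (at s)"
    using dt dg dt_eq by simp_all
qed

lemma Delta_inv_eq_inner: "Delta_inv c e s = vderiv c s \<bullet> normal_vec e s"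
  by (simp add: Delta_inv_def normal_vec_def dot_cross_det)


section \<open>Frames and striction lines of Bertrand offsets\<close>

lemma offset_frame:
  assumes "offset_dual_angle c e c1 e1 \<sigma> s (Dual \<theta> \<theta>s)"
  shows "e1 (\<sigma> s) = cos \<theta> *\<^sub>R e s - sin \<theta> *\<^sub>R normal_vec e s"
    and "tangent_vec e1 (\<sigma> s) = tangent_vec e s"
    and "normal_vec e1 (\<sigma> s) = sin \<theta> *\<^sub>R e s + cos \<theta> *\<^sub>R normal_vec e s"
  using assms
  by (simp_all add: offset_dual_angle_def dual_e_def dual_t_def dual_g_def line_dual_def
      dual_scale_def plus_dual_def minus_dual_def dual_extend_cos dual_extend_sin)

text \<open>The dual parts of \<open>t = t\<^sub>1\<close> give \<open>d \<times> t = 0\<close> for \<open>d = c\<^sub>1 - c\<close>, so \<open>d\<close> is a multiple of \<open>t\<close>.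
  The dual part of the relation for \<open>e\<^sub>1\<close> amounts to \<open>d \<times> e\<^sub>1 = - \<theta>\<^sup>* g\<^sub>1\<close>, and since \<open>t \<times> e\<^sub>1 = - g\<^sub>1\<close>,
  the multiple is \<open>\<theta>\<^sup>*\<close>.\<close>

lemma striction_lines_offset:
  assumes rs: "ruled_surface I c e" "s \<in> I" and rs1: "ruled_surface J c1 e1" "\<sigma> s \<in> J"
    and ang: "offset_dual_angle c e c1 e1 \<sigma> s (Dual \<theta> \<theta>s)"
  shows "c1 (\<sigma> s) - c s = \<theta>s *\<^sub>R tangent_vec e s"
proof -
  let ?d = "c1 (\<sigma> s) - c s" and ?t = "tangent_vec e s" and ?g1 = "normal_vec e1 (\<sigma> s)"
  note fr = offset_frame[OF ang]
  have "cross3 (c1 (\<sigma> s)) ?t = cross3 (c s) ?t"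
    using ang fr(2) by (simp add: offset_dual_angle_def dual_t_def line_dual_def)
  then have "cross3 ?t (cross3 ?d ?t) = 0"
    by (simp add: Cross3.left_diff_distrib)
  then have d: "?d = (?t \<bullet> ?d) *\<^sub>R ?t"
    using frame_orthonormal(2)[OF rs] by (simp add: Lagrange)
  have e1_eq: "dual_e c1 e1 (\<sigma> s) = dual_extend cos (Dual \<theta> \<theta>s) *\<^sub>D dual_e c e s
      - dual_extend sin (Dual \<theta> \<theta>s) *\<^sub>D dual_g c e s"
    using ang by (simp add: offset_dual_angle_def)
  have "cross3 (c1 (\<sigma> s)) (e1 (\<sigma> s)) = dual_part (dual_e c1 e1 (\<sigma> s))"
    by (simp add: dual_e_def line_dual_def)
  also have "\<dots> = cos \<theta> *\<^sub>R cross3 (c s) (e s) - (\<theta>s * sin \<theta>) *\<^sub>R e s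
      - (sin \<theta> *\<^sub>R cross3 (c s) (normal_vec e s) + (\<theta>s * cos \<theta>) *\<^sub>R normal_vec e s)"
    unfolding e1_eq
    by (simp add: dual_e_def dual_g_def line_dual_def
        dual_scale_def minus_dual_def dual_extend_cos dual_extend_sin)
  also have "\<dots> = cross3 (c s) (e1 (\<sigma> s)) - \<theta>s *\<^sub>R ?g1"
    by (simp add: fr cross_mult_right Cross3.right_diff_distrib algebra_simps)
  finally have "cross3 (c1 (\<sigma> s)) (e1 (\<sigma> s)) = cross3 (c s) (e1 (\<sigma> s)) - \<theta>s *\<^sub>R ?g1" .
  then have "cross3 ?d (e1 (\<sigma> s)) = - \<theta>s *\<^sub>R ?g1"
    by (simp add: Cross3.left_diff_distrib)
  moreover have "cross3 ?d (e1 (\<sigma> s)) = - (?t \<bullet> ?d) *\<^sub>R ?g1"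
    by (subst d) (simp add: cross_mult_left normal_vec_def fr(2) cross_skew[of ?t])
  moreover have "?g1 \<noteq> 0"
    using frame_orthonormal(4)[OF rs1] by auto
  ultimately have "?t \<bullet> ?d = \<theta>s" by simp
  with d show ?thesis by simp
qed


section \<open>The distribution parameter of a Bertrand offset\<close>

theorem theorem4p5:
  fixes c e c1 e1 :: "real \<Rightarrow> real^3"
    and \<sigma> \<theta> \<theta>s :: "real \<Rightarrow> real"
    and I J :: "real set"
    and s :: real
  assumes "bertrand_offset I c e J c1 e1 \<sigma>"
    and "\<forall>r\<in>I. offset_dual_angle c e c1 e1 \<sigma> r (Dual (\<theta> r) (\<theta>s r))"
    and "s \<in> I"
  shows "Delta_inv c1 e1 (\<sigma> s) =
           (Delta_inv c e s * cos (\<theta> s) + delta_inv c e s * sin (\<theta> s)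
             + \<theta>s s * (conical_curvature e s * cos (\<theta> s) - sin (\<theta> s)))
           / (cos (\<theta> s) + conical_curvature e s * sin (\<theta> s))"
proof -
  let ?t = "tangent_vec e s" and ?g = "normal_vec e s" and ?k = "conical_curvature e s"
    and ?g1 = "normal_vec e1 (\<sigma> s)" and ?d\<sigma> = "deriv \<sigma> s"
  define d where "d = (\<lambda>r. c1 (\<sigma> r) - c r)"
  define d' where "d' = ?d\<sigma> *\<^sub>R vderiv c1 (\<sigma> s) - vderiv c s"
  have rs: "ruled_surface I c e" and rs1: "ruled_surface J c1 e1" and nz: "?d\<sigma> \<noteq> 0"
    and \<sigma>J: "\<And>r. r \<in> I \<Longrightarrow> \<sigma> r \<in> J" and \<sigma>_diff: "\<sigma> differentiable (at s)"
    using assms(1,3) by (auto simp: bertrand_offset_def bij_betw_def)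
  have I: "open I" and sm: "smooth_curve_on I c" "smooth_curve_on I e"
    and sm1: "smooth_curve_on J c1" "smooth_curve_on J e1"
    using rs rs1 by (auto simp: ruled_surface_def)
  have d\<sigma>: "(\<sigma> has_vector_derivative ?d\<sigma>) (at s)"
    using \<sigma>_diff
    by (metis DERIV_deriv_iff_real_differentiable has_real_derivative_iff_has_vector_derivative)
  note on = frame_orthonormal[OF rs] and on1 = frame_orthonormal[OF rs1 \<sigma>J]
    and ang = assms(2)[THEN bspec]
  note fr = offset_frame[OF ang]
  note along_\<sigma> = vector_diff_chain_at[OF d\<sigma> smooth_curve_has_derivative(1)[OF _ \<sigma>J[OF assms(3)]],
      unfolded o_def]
  have de: "(e has_vector_derivative ?t) (at s)"
    using smooth_curve_has_derivative(1)[OF sm(2) assms(3)] by (simp add: tangent_vec_def)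
  note dt = frame_derivatives(1)[OF rs assms(3)] and dg = frame_derivatives(2)[OF rs assms(3)]
  have de1: "((\<lambda>r. e1 (\<sigma> r)) has_vector_derivative ?d\<sigma> *\<^sub>R ?t) (at s)"
    using along_\<sigma>[OF sm1(2)] fr(2)[OF assms(3)] by (simp add: tangent_vec_def)
  have dd: "(d has_vector_derivative d') (at s)"
    unfolding d_def d'_def
    by (intro has_vector_derivative_diff along_\<sigma>[OF sm1(1)]
        smooth_curve_has_derivative(1)[OF sm(1) assms(3)])
  have d_eq: "d r = \<theta>s r *\<^sub>R tangent_vec e r" if "r \<in> I" for r
    using striction_lines_offset[OF rs that rs1 \<sigma>J[OF that] ang[OF that]] by (simp add: d_def)

  \<comment> \<open>By the chain rule \<open>e\<^sub>1(\<sigma>)' = \<sigma>' t\<close>, so the component of \<open>e\<^sub>1(\<sigma>)'\<close> along \<open>t\<close> is \<open>\<sigma>'\<close>.\<close>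
  have "e1 (\<sigma> r) \<bullet> tangent_vec e r = 0" if "r \<in> I" for r
    using on1(3)[OF that] fr(2)[OF that] by simp
  from derivative_of_constant_inner[OF I assms(3) this de1 dt]
  have d\<sigma>_eq: "?d\<sigma> = cos (\<theta> s) + ?k * sin (\<theta> s)"
    using on[OF assms(3)] fr(1)[OF assms(3)]
    by (simp add: inner_diff_left inner_diff_right inner_commute algebra_simps)

  \<comment> \<open>Only the components of \<open>d'\<close> along \<open>e\<close> and \<open>g\<close> matter, since \<open>g\<^sub>1\<close> lies in their span.\<close>
  have "d r \<bullet> e r = 0" if "r \<in> I" for r
    using on(3)[OF that] d_eq[OF that] by (simp add: inner_commute)
  from derivative_of_constant_inner[OF I assms(3) this dd de]
  have d'_e: "d' \<bullet> e s = - \<theta>s s"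
    using on(2)[OF assms(3)] d_eq[OF assms(3)] by simp
  have "d r \<bullet> normal_vec e r = 0" if "r \<in> I" for r
    using on(6)[OF that] d_eq[OF that] by simp
  from derivative_of_constant_inner[OF I assms(3) this dd dg]
  have d'_g: "d' \<bullet> ?g = \<theta>s s * ?k"
    using on(2)[OF assms(3)] d_eq[OF assms(3)] by simp

  have "?d\<sigma> * Delta_inv c1 e1 (\<sigma> s) = (vderiv c s + d') \<bullet> ?g1"
    by (simp add: Delta_inv_eq_inner d'_def)
  also have "\<dots> = Delta_inv c e s * cos (\<theta> s) + delta_inv c e s * sin (\<theta> s)
      + \<theta>s s * (?k * cos (\<theta> s) - sin (\<theta> s))"
    using d'_e d'_g fr(3)[OF assms(3)]
    by (simp add: Delta_inv_eq_inner delta_inv_def inner_add_left inner_add_right algebra_simps)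
  finally show ?thesis
    using nz by (simp add: d\<sigma>_eq field_simps)
qed

end
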